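(* Let $W$ be an NDCSE with respect to a closed abelian subgroup $H\subseteq G$, fix $(\eta,i)$, and let $E\subseteq\mathrm{End}(\mathcal H^{\eta,i})$ be a $G$-irreducible submodule isomorphic to the irrep $\lambda$, with a Hilbert–Schmidt orthonormal basis $\{e_\sigma\}$ each element of which is either diagonal in $W$ or has all diagonal entries $\langle w|e_\sigma|w\rangle=0$. Let $D$ be the set of indices $\sigma$ with $e_\sigma$ diagonal, and $\lambda(g)_{\sigma,\tau}=\mathrm{Tr}[e_\sigma^\dagger R(g)e_\tau R(g)^\dagger]$. Then for every $\tau$, $$\int_G\sum_{\sigma\in D}|\lambda(g)_{\sigma,\tau}|^2\,dg=a^H_\lambda=\frac{d^H_\lambda}{d_\lambda}.$$
   Context: $G$ compact group with normalized Haar measure $dg$; $R:G\to\mathsf U(\mathcal H)$ continuous unitary representation, $\dim\mathcal H<\infty$; $G$ acts on $\mathrm{End}(\mathcal H)$ by $X\mapsto R(g)XR(g)^\dagger$. An NDCSE w.r.t. abelian $H\subseteq G$ is an orthonormal basis $W=\bigcup_{\eta,i}W^{\eta,i}$, $W^{\eta,i}$ an orthonormal basis of $\mathcal H^{\eta,i}$ for a decomposition $\mathcal H=\bigoplus\mathcal H^{\eta,i}$ into irreducible $G$-submodules, whose elements are simultaneous eigenvectors of $R(H)$, with each $\mathcal H^{\eta,i}$ multiplicity-free as an $H$-module. $d_\lambda=\dim V^\lambda$, $d^H_\lambda=$ dimension of the $H$-fixed subspace of $V^\lambda$. *)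

theory Defs
  imports "HOL-Analysis.Analysis"
begin

section \<open>Linear algebra on C^n (finite-dimensional Hilbert space)\<close>

definition cinner :: "complex^'n \<Rightarrow> complex^'n \<Rightarrow> complex" where
  "cinner u v = (\<Sum>i\<in>UNIV. cnj (u$i) * v$i)"

definition adj :: "complex^'n^'m \<Rightarrow> complex^'m^'n" where
  "adj A = (\<chi> i j. cnj (A$j$i))"

definition unitary_mat :: "complex^'n^'n \<Rightarrow> bool" where
  "unitary_mat U \<longleftrightarrow> U ** adj U = mat 1 \<and> adj U ** U = mat 1"

definition mscale :: "complex \<Rightarrow> complex^'n^'m \<Rightarrow> complex^'n^'m" where
  "mscale c A = (\<chi> i j. c * A$i$j)"

text \<open>Hilbert-Schmidt inner product Tr(A^dagger B).\<close>
definition hs_inner :: "complex^'n^'n \<Rightarrow> complex^'n^'n \<Rightarrow> complex" where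
  "hs_inner A B = trace (adj A ** B)"

section \<open>Compact groups, Haar measure, closed abelian subgroups\<close>

definition compact_group :: "('g::topological_space \<Rightarrow> 'g \<Rightarrow> 'g) \<Rightarrow> 'g \<Rightarrow> ('g \<Rightarrow> 'g) \<Rightarrow> bool" where
  "compact_group mul e iv \<longleftrightarrow> group mul e iv \<and> compact (UNIV :: 'g set) \<and>
     continuous_on UNIV (\<lambda>p. mul (fst p) (snd p)) \<and> continuous_on UNIV iv"

text \<open>Normalized Haar measure: a left-invariant regular Borel probability measure.\<close>
definition normalized_haar :: "('g::topological_space \<Rightarrow> 'g \<Rightarrow> 'g) \<Rightarrow> 'g measure \<Rightarrow> bool" where
  "normalized_haar mul \<mu> \<longleftrightarrow> sets \<mu> = sets borel \<and> emeasure \<mu> (space \<mu>) = 1 \<and>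
     (\<forall>g. \<forall>A\<in>sets borel. emeasure \<mu> ((mul g) ` A) = emeasure \<mu> A) \<and>
     (\<forall>A\<in>sets borel. emeasure \<mu> A = (INF U\<in>{U. open U \<and> A \<subseteq> U}. emeasure \<mu> U)) \<and>
     (\<forall>U. open U \<longrightarrow> emeasure \<mu> U = (SUP K\<in>{K. compact K \<and> K \<subseteq> U}. emeasure \<mu> K))"

definition closed_abelian_subgroup ::
  "('g::topological_space \<Rightarrow> 'g \<Rightarrow> 'g) \<Rightarrow> 'g \<Rightarrow> ('g \<Rightarrow> 'g) \<Rightarrow> 'g set \<Rightarrow> bool" where
  "closed_abelian_subgroup mul e iv Hs \<longleftrightarrow> closed Hs \<and> e \<in> Hs \<and>
     (\<forall>x\<in>Hs. \<forall>y\<in>Hs. mul x y \<in> Hs) \<and> (\<forall>x\<in>Hs. iv x \<in> Hs) \<and>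
     (\<forall>x\<in>Hs. \<forall>y\<in>Hs. mul x y = mul y x)"

text \<open>Continuous unitary representation G -> U(C^n).\<close>
definition cont_unitary_rep ::
  "('g::topological_space \<Rightarrow> 'g \<Rightarrow> 'g) \<Rightarrow> 'g \<Rightarrow> ('g \<Rightarrow> complex^'n^'n) \<Rightarrow> bool" where
  "cont_unitary_rep mul e R \<longleftrightarrow> (\<forall>g h. R (mul g h) = R g ** R h) \<and> R e = mat 1 \<and>
     (\<forall>g. unitary_mat (R g)) \<and> (\<forall>i j. continuous_on UNIV (\<lambda>g. R g $ i $ j))"

section \<open>Modules for a group action (linear action act of the elements of K)\<close>

definition invariant_subspace ::
  "('c::comm_ring_1 \<Rightarrow> 'v::ab_group_add \<Rightarrow> 'v) \<Rightarrow> ('g \<Rightarrow> 'v \<Rightarrow> 'v) \<Rightarrow> 'g set \<Rightarrow> 'v set \<Rightarrow> bool" where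
  "invariant_subspace sc act K V \<longleftrightarrow> module.subspace sc V \<and> (\<forall>g\<in>K. \<forall>x\<in>V. act g x \<in> V)"

definition irreducible_submodule ::
  "('c::comm_ring_1 \<Rightarrow> 'v::ab_group_add \<Rightarrow> 'v) \<Rightarrow> ('g \<Rightarrow> 'v \<Rightarrow> 'v) \<Rightarrow> 'g set \<Rightarrow> 'v set \<Rightarrow> bool" where
  "irreducible_submodule sc act K V \<longleftrightarrow> invariant_subspace sc act K V \<and> V \<noteq> {0} \<and>
     (\<forall>U. invariant_subspace sc act K U \<and> U \<subseteq> V \<longrightarrow> U = {0} \<or> U = V)"

definition isomorphic_modules ::
  "('c::field \<Rightarrow> 'v::ab_group_add \<Rightarrow> 'v) \<Rightarrow> ('g \<Rightarrow> 'v \<Rightarrow> 'v) \<Rightarrow> 'v set \<Rightarrow>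
   ('c \<Rightarrow> 'w::ab_group_add \<Rightarrow> 'w) \<Rightarrow> ('g \<Rightarrow> 'w \<Rightarrow> 'w) \<Rightarrow> 'w set \<Rightarrow> 'g set \<Rightarrow> bool" where
  "isomorphic_modules s1 a1 V1 s2 a2 V2 K \<longleftrightarrow>
     (\<exists>T. Vector_Spaces.linear s1 s2 T \<and> bij_betw T V1 V2 \<and>
          (\<forall>g\<in>K. \<forall>x\<in>V1. T (a1 g x) = a2 g (T x)))"

text \<open>Multiplicity-free: any two isomorphic irreducible submodules of V coincide.\<close>
definition multiplicity_free ::
  "('c::field \<Rightarrow> 'v::ab_group_add \<Rightarrow> 'v) \<Rightarrow> ('g \<Rightarrow> 'v \<Rightarrow> 'v) \<Rightarrow> 'g set \<Rightarrow> 'v set \<Rightarrow> bool" where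
  "multiplicity_free sc act K V \<longleftrightarrow>
     (\<forall>U1 U2. irreducible_submodule sc act K U1 \<and> U1 \<subseteq> V \<and>
              irreducible_submodule sc act K U2 \<and> U2 \<subseteq> V \<and>
              isomorphic_modules sc act U1 sc act U2 K \<longrightarrow> U1 = U2)"

section \<open>NDCSE\<close>

text \<open>The orthonormal basis W is w : 'n => C^n; blk j is the label (eta,i) of the block
  H^{eta,i} containing w j, so that H^{eta,i} = span {w j | blk j = (eta,i)}.\<close>
definition block_space :: "('n \<Rightarrow> complex^'n) \<Rightarrow> ('n \<Rightarrow> 'k) \<Rightarrow> 'k \<Rightarrow> (complex^'n) set" where
  "block_space w blk k = vec.span (w ` {j. blk j = k})"

definition NDCSE ::
  "('g \<Rightarrow> complex^'n^'n) \<Rightarrow> 'g set \<Rightarrow> ('n \<Rightarrow> complex^'n) \<Rightarrow> ('n \<Rightarrow> 'k) \<Rightarrow> bool" where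
  "NDCSE R Hs w blk \<longleftrightarrow>
     (\<forall>j j'. cinner (w j) (w j') = (if j = j' then 1 else 0)) \<and>
     (\<forall>k\<in>range blk. irreducible_submodule (*s) (\<lambda>g v. R g *v v) UNIV (block_space w blk k)) \<and>
     (\<forall>j. \<forall>h\<in>Hs. \<exists>c. R h *v w j = c *s w j) \<and>
     (\<forall>k\<in>range blk. multiplicity_free (*s) (\<lambda>g v. R g *v v) Hs (block_space w blk k))"

text \<open>End(H^{eta,i}) realised as the operators on H that preserve H^{eta,i} and vanish on
  its orthogonal complement (spanned by the other basis vectors).\<close>
definition End_block :: "('n \<Rightarrow> complex^'n) \<Rightarrow> ('n \<Rightarrow> 'k) \<Rightarrow> 'k \<Rightarrow> (complex^'n^'n) set" where
  "End_block w blk k = {X. (\<forall>v\<in>block_space w blk k. X *v v \<in> block_space w blk k) \<and>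
                            (\<forall>j. blk j \<noteq> k \<longrightarrow> X *v w j = 0)}"

definition conj_action :: "('g \<Rightarrow> complex^'n^'n) \<Rightarrow> 'g \<Rightarrow> complex^'n^'n \<Rightarrow> complex^'n^'n" where
  "conj_action R g X = R g ** X ** adj (R g)"

definition diagonal_in :: "('n \<Rightarrow> complex^'n) \<Rightarrow> ('n \<Rightarrow> 'k) \<Rightarrow> 'k \<Rightarrow> complex^'n^'n \<Rightarrow> bool" where
  "diagonal_in w blk k X \<longleftrightarrow>
     (\<forall>j j'. blk j = k \<and> blk j' = k \<and> j \<noteq> j' \<longrightarrow> cinner (w j) (X *v w j') = 0)"

definition zero_diagonal_in :: "('n \<Rightarrow> complex^'n) \<Rightarrow> ('n \<Rightarrow> 'k) \<Rightarrow> 'k \<Rightarrow> complex^'n^'n \<Rightarrow> bool" where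
  "zero_diagonal_in w blk k X \<longleftrightarrow> (\<forall>j. blk j = k \<longrightarrow> cinner (w j) (X *v w j) = 0)"

text \<open>d^H_lambda: dimension of the H-fixed subspace of the irrep space.\<close>
definition fixed_dim :: "('g \<Rightarrow> complex^'d^'d) \<Rightarrow> 'g set \<Rightarrow> nat" where
  "fixed_dim \<rho> Hs = vec.dim {v :: complex^'d. \<forall>h\<in>Hs. \<rho> h *v v = v}"

end

theory Submission
  imports Defs "Jordan_Normal_Form.Spectral_Radius"
begin

text \<open>
  Through the isomorphism \<open>V\<^sup>\<lambda> \<cong> E\<close>, the \<open>H\<close>-fixed vectors of \<open>\<lambda>\<close> correspond to the operators
  in \<open>E\<close> commuting with \<open>R(H)\<close>. Since every \<open>w\<^sub>j\<close> is an \<open>H\<close>-eigenvector and \<open>\<H>\<^sup>\<eta>\<^sup>,\<^sup>i\<close> is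
  multiplicity-free as an \<open>H\<close>-module, two basis vectors of the block carry different characters
  of \<open>H\<close>; hence an operator on the block commutes with \<open>R(H)\<close> iff it is diagonal in \<open>W\<close>.
  Diagonal operators are Hilbert-Schmidt orthogonal to those with zero diagonal, so the
  diagonal \<open>e\<^sub>\<sigma>\<close> form a basis of the fixed operators in \<open>E\<close> and \<open>|D| = d\<^sup>H\<^sub>\<lambda>\<close>.
  Finally, by Schur orthogonality each \<open>|\<lambda>(g)\<^sub>\<sigma>\<^sub>\<tau>|\<^sup>2\<close> has Haar average \<open>1/d\<^sub>\<lambda>\<close>: averaging
  \<open>\<lambda>(g) P\<^sub>\<tau> \<lambda>(g)\<^sup>\<dagger>\<close> gives a matrix commuting with \<open>\<lambda>(G)\<close>, hence a scalar, and its trace is 1.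
\<close>

hide_const (open) Matrix.mat
hide_const LinearCombinations.module.span
no_notation Matrix.vec_index (infixl \<open>$\<close> 100)

section \<open>Eigenvectors of complex matrices\<close>

lemma finite_type_enumeration:
  obtains h :: "nat \<Rightarrow> 'a::finite" and hi
  where "bij_betw h {0..<CARD('a)} UNIV" and "\<And>s. hi s < CARD('a)" and "\<And>s. h (hi s) = s"
    and "\<And>i. i < CARD('a) \<Longrightarrow> hi (h i) = i"
proof -
  obtain h :: "nat \<Rightarrow> 'a" where h: "bij_betw h {0..<CARD('a)} UNIV"
    using ex_bij_betw_nat_finite[of "UNIV :: 'a set"] by auto
  define hi where "hi = inv_into {0..<CARD('a)} h"
  show thesis
  proof (rule that[OF h])
    show "hi s < CARD('a)" for s
      using h unfolding hi_def by (metis atLeastLessThan_iff bij_betw_def inv_into_into UNIV_I)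
    show "h (hi s) = s" for s
      using h unfolding hi_def by (simp add: bij_betw_inv_into_right)
    show "i < CARD('a) \<Longrightarrow> hi (h i) = i" for i
      using h unfolding hi_def by (simp add: bij_betw_inv_into_left)
  qed
qed

lemma complex_matrix_has_eigenvector:
  fixes M :: "complex^'s^'s"
  obtains v l where "v \<noteq> 0" and "M *v v = l *s v"
proof -
  define n where "n = CARD('s)"
  obtain h :: "nat \<Rightarrow> 's" and hi where h: "bij_betw h {0..<n} UNIV" and hi_less: "\<And>s. hi s < n"
    and h_hi: "\<And>s. h (hi s) = s" and hi_h: "\<And>i. i < n \<Longrightarrow> hi (h i) = i"
    unfolding n_def by (rule finite_type_enumeration[where 'a = 's]) iprover
  define A where "A = Matrix.mat n n (\<lambda>(i, j). M $ h i $ h j)"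
  have A: "A \<in> carrier_mat n n" unfolding A_def by simp
  obtain l where "eigenvalue A l"
    using spectrum_non_empty[OF A] unfolding spectrum_def n_def by auto
  then obtain u where "eigenvector A u l" unfolding eigenvalue_def by blast
  hence u_dim: "dim_vec u = n" and u_nz: "u \<noteq> 0\<^sub>v n" and u_eig: "A *\<^sub>v u = l \<cdot>\<^sub>v u"
    using A unfolding eigenvector_def by auto
  define v :: "complex^'s" where "v = (\<chi> s. vec_index u (hi s))"
  have v_h: "j < n \<Longrightarrow> v $ h j = vec_index u j" for j
    by (simp add: v_def hi_h)
  have "(M *v v) $ s = (l *s v) $ s" for s
  proof -
    have "(M *v v) $ s = (\<Sum>j\<in>{0..<n}. M $ s $ h j * v $ h j)"
      using sum.reindex_bij_betw[OF h, of "\<lambda>j. M $ s $ j * v $ j"]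
      by (simp add: matrix_vector_mult_def)
    also have "\<dots> = vec_index (A *\<^sub>v u) (hi s)"
      using hi_less[of s] u_dim h_hi
      by (auto simp: A_def scalar_prod_def v_h intro!: sum.cong)
    also have "\<dots> = (l *s v) $ s"
      using hi_less[of s] u_dim A by (simp add: u_eig v_def)
    finally show ?thesis .
  qed
  hence "M *v v = l *s v" by (simp add: Finite_Cartesian_Product.vec_eq_iff)
  moreover have "v \<noteq> 0"
  proof
    assume "v = 0"
    hence "u = 0\<^sub>v n"
      by (intro eq_vecI) (auto simp: u_dim v_h[symmetric])
    with u_nz show False ..
  qed
  ultimately show thesis using that by blast
qed

section \<open>Matrices, the Hilbert-Schmidt inner product and conjugation\<close>

lemma sum_mult_delta_left [simp]:
  "(\<Sum>j\<in>(UNIV::'a::finite set). f j * (if i = j then 1 else (0::'b::comm_semiring_1))) = f i"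
  by (simp add: if_distrib cong: if_cong)

lemma sum_mult_delta_right [simp]:
  "(\<Sum>j\<in>(UNIV::'a::finite set). f j * (if j = i then 1 else (0::'b::comm_semiring_1))) = f i"
  by (simp add: if_distrib cong: if_cong)

lemma sum_matrix_component:
  "(\<Sum>x\<in>S. f x :: 'a::comm_monoid_add^'n^'m) $ i $ j = (\<Sum>x\<in>S. f x $ i $ j)"
  by (induction S rule: infinite_finite_induct) auto

lemma matrix_vector_mult_smult: "A *v (c *s v) = c *s (A *v (v::'a::comm_ring_1^'n))"
  by (simp add: matrix_vector_mult_def Finite_Cartesian_Product.vec_eq_iff sum_distrib_left
      algebra_simps)

lemma matrix_vector_mult_sum:
  "A *v (\<Sum>x\<in>S. f x) = (\<Sum>x\<in>S. A *v (f x :: 'a::comm_ring_1^'n))"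
  by (induction S rule: infinite_finite_induct) (auto simp: matrix_vector_right_distrib)

lemma adj_adj [simp]: "adj (adj A) = A"
  by (simp add: adj_def Finite_Cartesian_Product.vec_eq_iff)

lemma adj_matrix_mult: "adj (A ** B) = adj B ** adj A"
  by (simp add: adj_def matrix_matrix_mult_def Finite_Cartesian_Product.vec_eq_iff mult.commute)

lemma mscale_component [simp]: "mscale c A $ i $ j = c * A $ i $ j"
  by (simp add: mscale_def)

lemma module_mscale: "Modules.module (mscale :: complex \<Rightarrow> complex^'n^'m \<Rightarrow> complex^'n^'m)"
  by unfold_locales (auto simp: Finite_Cartesian_Product.vec_eq_iff algebra_simps)

lemma hs_inner_eq_sum: "hs_inner A B = (\<Sum>i\<in>UNIV. \<Sum>j\<in>UNIV. cnj (A$i$j) * B$i$j)"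
proof -
  have "hs_inner A B = (\<Sum>j\<in>UNIV. \<Sum>i\<in>UNIV. cnj (A$i$j) * B$i$j)"
    by (simp add: hs_inner_def Determinants.trace_def matrix_matrix_mult_def adj_def)
  also have "\<dots> = (\<Sum>i\<in>UNIV. \<Sum>j\<in>UNIV. cnj (A$i$j) * B$i$j)"
    by (rule sum.swap)
  finally show ?thesis .
qed

lemma hs_inner_mscale_right [simp]: "hs_inner A (mscale c B) = c * hs_inner A B"
  by (simp add: hs_inner_eq_sum sum_distrib_left algebra_simps)

lemma hs_inner_zero_right [simp]: "hs_inner A 0 = 0"
  by (simp add: hs_inner_eq_sum)

lemma hs_inner_add_right: "hs_inner A (B + C) = hs_inner A B + hs_inner A C"
  by (simp add: hs_inner_eq_sum sum.distrib algebra_simps)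

lemma hs_inner_sum_right: "hs_inner A (\<Sum>x\<in>S. f x) = (\<Sum>x\<in>S. hs_inner A (f x))"
proof -
  have "hs_inner A (\<Sum>x\<in>S. f x) = (\<Sum>i\<in>UNIV. \<Sum>j\<in>UNIV. \<Sum>x\<in>S. cnj (A$i$j) * f x$i$j)"
    by (simp add: hs_inner_eq_sum sum_matrix_component sum_distrib_left)
  also have "\<dots> = (\<Sum>x\<in>S. \<Sum>i\<in>UNIV. \<Sum>j\<in>UNIV. cnj (A$i$j) * f x$i$j)"
    by (subst sum.swap) (simp add: sum.swap[of _ UNIV S])
  finally show ?thesis by (simp add: hs_inner_eq_sum)
qed

lemma hs_inner_commute: "hs_inner B A = cnj (hs_inner A B)"
  by (simp add: hs_inner_eq_sum mult.commute)

lemma conj_action_component: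
  "conj_action R g X $ i $ j = (\<Sum>l\<in>UNIV. (\<Sum>k\<in>UNIV. R g $ i $ k * X $ k $ l) * cnj (R g $ j $ l))"
  by (simp add: conj_action_def matrix_matrix_mult_def adj_def)

lemma conj_action_mscale: "conj_action R g (mscale c X) = mscale c (conj_action R g X)"
  by (simp add: Finite_Cartesian_Product.vec_eq_iff conj_action_component sum_distrib_left
      algebra_simps)

lemma conj_action_add: "conj_action R g (X + Y) = conj_action R g X + conj_action R g Y"
  by (simp add: Finite_Cartesian_Product.vec_eq_iff conj_action_component sum.distrib algebra_simps)

lemma conj_action_sum:
  "finite S \<Longrightarrow> conj_action R g (\<Sum>x\<in>S. f x) = (\<Sum>x\<in>S. conj_action R g (f x))"
  by (induction S rule: finite_induct)
    (auto simp: conj_action_add Finite_Cartesian_Product.vec_eq_iff conj_action_component)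

lemma conj_action_mult:
  assumes "R (mul g h) = R g ** R h"
  shows "conj_action R (mul g h) X = conj_action R g (conj_action R h X)"
  unfolding conj_action_def assms adj_matrix_mult by (simp add: matrix_mul_assoc)

lemma hs_inner_conj_action:
  assumes "unitary_mat (R g)"
  shows "hs_inner (conj_action R g X) (conj_action R g Y) = hs_inner X Y"
proof -
  have u: "adj (R g) ** R g = mat 1" using assms by (simp add: unitary_mat_def)
  have "hs_inner (conj_action R g X) (conj_action R g Y)
      = trace (R g ** adj X ** (adj (R g) ** R g) ** Y ** adj (R g))"
    unfolding hs_inner_def conj_action_def adj_matrix_mult adj_adj by (simp add: matrix_mul_assoc)
  also have "\<dots> = trace (R g ** (adj X ** Y ** adj (R g)))"
    by (simp add: u matrix_mul_assoc)
  also have "\<dots> = trace (adj X ** Y ** adj (R g) ** R g)"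
    by (subst trace_mul_sym) (simp add: matrix_mul_assoc)
  also have "\<dots> = hs_inner X Y" by (simp add: hs_inner_def u matrix_mul_assoc[symmetric])
  finally show ?thesis .
qed

lemma trace_adj_conj_action:
  "trace (adj A ** R g ** B ** adj (R g)) = hs_inner A (conj_action R g B)"
  unfolding hs_inner_def conj_action_def by (simp add: matrix_mul_assoc)

section \<open>Orthonormal bases of \<open>\<complex>\<^sup>n\<close>\<close>

lemma cinner_smult_right [simp]: "cinner u (a *s v) = a * cinner u v"
  by (simp add: cinner_def sum_distrib_left algebra_simps)

lemma cinner_smult_left [simp]: "cinner (a *s u) v = cnj a * cinner u v"
  by (simp add: cinner_def sum_distrib_left algebra_simps)

lemma cinner_zero_right [simp]: "cinner u 0 = 0"
  by (simp add: cinner_def)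

lemma cinner_add_right: "cinner u (v1 + v2) = cinner u v1 + cinner u v2"
  by (simp add: cinner_def sum.distrib algebra_simps)

lemma cinner_sum_right: "cinner u (\<Sum>x\<in>S. f x) = (\<Sum>x\<in>S. cinner u (f x))"
  by (induction S rule: infinite_finite_induct) (simp_all add: cinner_add_right)

lemma cinner_commute: "cinner v u = cnj (cinner u v)"
  by (simp add: cinner_def mult.commute)

lemma cinner_adj: "cinner (A *v u) v = cinner u (adj A *v v)"
proof -
  have "cinner (A *v u) v = (\<Sum>i\<in>UNIV. \<Sum>j\<in>UNIV. cnj (A$i$j) * cnj (u$j) * v$i)"
    by (simp add: cinner_def matrix_vector_mult_def sum_distrib_right)
  also have "\<dots> = (\<Sum>j\<in>UNIV. \<Sum>i\<in>UNIV. cnj (A$i$j) * cnj (u$j) * v$i)"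
    by (rule sum.swap)
  also have "\<dots> = cinner u (adj A *v v)"
    by (simp add: cinner_def matrix_vector_mult_def adj_def sum_distrib_left algebra_simps)
  finally show ?thesis .
qed

definition onb :: "('n \<Rightarrow> complex^'n) \<Rightarrow> bool" where
  "onb w \<longleftrightarrow> (\<forall>j j'. cinner (w j) (w j') = (if j = j' then 1 else 0))"

lemma onb_nonzero: "onb w \<Longrightarrow> w i \<noteq> 0"
  unfolding onb_def by (metis cinner_zero_right zero_neq_one)

lemma onb_inj: "onb w \<Longrightarrow> inj w"
  unfolding onb_def inj_def by (metis zero_neq_one)

lemma onb_cinner_combination:
  "onb w \<Longrightarrow> cinner (w i) (\<Sum>j\<in>UNIV. c j *s w j) = c i"
  by (simp add: cinner_sum_right onb_def)

lemma onb_span: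
  fixes w :: "'n::finite \<Rightarrow> complex^'n"
  assumes "onb w"
  shows "vec.span (range w) = UNIV"
proof -
  have ind: "vec.independent (range w)"
  proof
    assume "vec.dependent (range w)"
    then obtain u where u: "\<exists>v\<in>range w. u v \<noteq> 0" "(\<Sum>v\<in>range w. u v *s v) = 0"
      using vec.dependent_finite[of "range w"] by auto
    have "(\<Sum>j\<in>UNIV. u (w j) *s w j) = 0"
      using u(2) sum.reindex[OF onb_inj[OF assms], of "\<lambda>v. u v *s v"] by simp
    hence "u (w i) = 0" for i
      using onb_cinner_combination[OF assms, of i "\<lambda>j. u (w j)"] by simp
    with u(1) show False by auto
  qed
  have "card (range w) = CARD('n)" using onb_inj[OF assms] by (simp add: card_image)
  hence "vec.dim (vec.span (range w)) = vec.dim (UNIV :: (complex^'n) set)"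
    using vec.dim_eq_card_independent[OF ind] by (simp add: card_cart_basis)
  thus ?thesis by (intro vec.subspace_dim_equal) auto
qed

lemma onb_expansion:
  fixes w :: "'n::finite \<Rightarrow> complex^'n"
  assumes "onb w"
  shows "x = (\<Sum>j\<in>UNIV. cinner (w j) x *s w j)"
proof -
  obtain u where "x = (\<Sum>v\<in>range w. u v *s v)"
    using onb_span[OF assms] vec.span_finite[of "range w"] by auto
  hence x: "x = (\<Sum>j\<in>UNIV. u (w j) *s w j)"
    using sum.reindex[OF onb_inj[OF assms], of "\<lambda>v. u v *s v"] by simp
  have "cinner (w i) x = u (w i)" for i
    unfolding x by (rule onb_cinner_combination[OF assms])
  thus ?thesis using x by simp
qed

lemma onb_sum_components:
  fixes w :: "'n::finite \<Rightarrow> complex^'n"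
  assumes "onb w"
  shows "(\<Sum>j\<in>UNIV. cnj (w j $ b) * w j $ a) = (if a = b then 1 else 0)"
proof -
  have "cinner (w j) (axis b 1) = cnj (w j $ b)" for j
    by (simp add: cinner_def axis_def)
  thus ?thesis
    using arg_cong[OF onb_expansion[OF assms, of "axis b 1"], of "\<lambda>x. x $ a"]
    by (simp add: sum_component axis_def)
qed

lemma onb_trace:
  fixes w :: "'n::finite \<Rightarrow> complex^'n"
  assumes "onb w"
  shows "trace C = (\<Sum>j\<in>UNIV. cinner (w j) (C *v w j))"
proof -
  have "(\<Sum>j\<in>UNIV. cinner (w j) (C *v w j))
      = (\<Sum>j\<in>UNIV. \<Sum>a\<in>UNIV. \<Sum>b\<in>UNIV. C$a$b * (cnj (w j $ a) * w j $ b))"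
    by (simp add: cinner_def matrix_vector_mult_def sum_distrib_left algebra_simps)
  also have "\<dots> = (\<Sum>a\<in>UNIV. \<Sum>b\<in>UNIV. \<Sum>j\<in>UNIV. C$a$b * (cnj (w j $ a) * w j $ b))"
    by (subst sum.swap) (rule sum.cong[OF refl], rule sum.swap)
  also have "\<dots> = trace C"
    by (simp add: sum_distrib_left[symmetric] onb_sum_components[OF assms] Determinants.trace_def)
  finally show ?thesis by simp
qed

lemma onb_matrix_eqI:
  fixes w :: "'n::finite \<Rightarrow> complex^'n"
  assumes "onb w" and "\<And>i j. cinner (w i) (A *v w j) = cinner (w i) (B *v w j)"
  shows "A = B"
proof -
  have "A *v w j = B *v w j" for j
    using onb_expansion[OF assms(1), of "A *v w j"] onb_expansion[OF assms(1), of "B *v w j"]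
      assms(2) by simp
  hence "A *v x = B *v x" for x
    by (subst (1 2) onb_expansion[OF assms(1), of x]) (simp add: matrix_vector_mult_sum
        matrix_vector_mult_smult)
  thus ?thesis by (simp add: matrix_eq)
qed

section \<open>Normalized Haar measure\<close>

lemma normalized_haar_sets: "normalized_haar mul \<mu> \<Longrightarrow> sets \<mu> = sets borel"
  unfolding normalized_haar_def by (elim conjE)

lemma normalized_haar_space: "normalized_haar mul \<mu> \<Longrightarrow> space \<mu> = UNIV"
  using sets_eq_imp_space_eq[OF normalized_haar_sets] by simp

lemma normalized_haar_measure_space: "normalized_haar mul \<mu> \<Longrightarrow> measure \<mu> (space \<mu>) = 1"
  unfolding normalized_haar_def by (simp add: measure_def)

lemma normalized_haar_finite_measure: "normalized_haar mul \<mu> \<Longrightarrow> finite_measure \<mu>"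
  unfolding normalized_haar_def by (intro finite_measureI) simp

lemma borel_measurable_haar:
  "normalized_haar mul \<mu> \<Longrightarrow> f \<in> borel_measurable borel \<Longrightarrow> f \<in> borel_measurable \<mu>"
  using measurable_cong_sets[OF normalized_haar_sets refl] by blast

lemma integrable_haar_bounded_continuous:
  fixes f :: "'g::topological_space \<Rightarrow> 'b::{banach, second_countable_topology}"
  assumes haar: "normalized_haar mul \<mu>"
    and "continuous_on UNIV f" and "\<And>g. norm (f g) \<le> B"
  shows "integrable \<mu> f"
proof (rule finite_measure.integrable_const_bound)
  show "finite_measure \<mu>" by (rule normalized_haar_finite_measure[OF haar])
  show "AE x in \<mu>. norm (f x) \<le> B" using assms(3) by simp
  show "f \<in> borel_measurable \<mu>"
    by (rule borel_measurable_haar[OF haar borel_measurable_continuous_onI[OF assms(2)]])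
qed

lemma continuous_on_mul_left:
  assumes "compact_group mul e iv"
  shows "continuous_on UNIV (mul h)"
proof -
  have "continuous_on UNIV (\<lambda>p. mul (fst p) (snd p))"
    using assms unfolding compact_group_def by auto
  hence "continuous_on UNIV ((\<lambda>p. mul (fst p) (snd p)) \<circ> (\<lambda>g. (h, g)))"
    by (intro continuous_on_compose continuous_intros) (auto intro: continuous_on_subset)
  thus ?thesis by (simp add: o_def)
qed

lemma integral_haar_mul_left:
  fixes f :: "'g::t2_space \<Rightarrow> 'b::{banach, second_countable_topology}"
  assumes G: "compact_group mul e iv" and haar: "normalized_haar mul \<mu>"
    and f: "f \<in> borel_measurable borel"
  shows "(\<integral>g. f (mul h g) \<partial>\<mu>) = (\<integral>g. f g \<partial>\<mu>)"
proof -
  interpret grp: Groups.group mul e iv using G unfolding compact_group_def by auto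
  have sets: "sets \<mu> = sets borel" by (rule normalized_haar_sets[OF haar])
  have m: "mul h \<in> measurable \<mu> \<mu>"
    using borel_measurable_continuous_onI[OF continuous_on_mul_left[OF G]]
    by (simp add: measurable_cong_sets[OF sets sets])
  have "distr \<mu> \<mu> (mul h) = \<mu>"
  proof (rule measure_eqI)
    fix A assume "A \<in> sets (distr \<mu> \<mu> (mul h))"
    hence A: "A \<in> sets borel" using sets by simp
    have "mul (iv h) (mul h x) = x" "mul h (mul (iv h) x) = x" for x
      by (metis grp.assoc grp.left_inverse grp.right_inverse grp.group_left_neutral)+
    hence "mul h -` A \<inter> space \<mu> = mul (iv h) ` A"
      unfolding normalized_haar_space[OF haar] by (auto simp: image_iff) metis
    hence "emeasure (distr \<mu> \<mu> (mul h)) A = emeasure \<mu> (mul (iv h) ` A)"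
      using A sets m by (simp add: emeasure_distr)
    also have "\<dots> = emeasure \<mu> A" using haar A unfolding normalized_haar_def by auto
    finally show "emeasure (distr \<mu> \<mu> (mul h)) A = emeasure \<mu> A" .
  qed simp
  hence "(\<integral>g. f g \<partial>\<mu>) = (\<integral>g. f g \<partial>(distr \<mu> \<mu> (mul h)))" by simp
  also have "\<dots> = (\<integral>g. f (mul h g) \<partial>\<mu>)"
    by (rule integral_distr[OF m borel_measurable_haar[OF haar f]])
  finally show ?thesis by simp
qed

section \<open>Basis vectors that are eigenvectors of \<open>R(H)\<close>\<close>

definition basis_eigenvalue ::
  "('g \<Rightarrow> complex^'n^'n) \<Rightarrow> ('n \<Rightarrow> complex^'n) \<Rightarrow> 'g \<Rightarrow> 'n \<Rightarrow> complex" where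
  "basis_eigenvalue R w h j = cinner (w j) (R h *v w j)"

lemma basis_eigenvalue_eigenvector:
  assumes "onb w" and "\<exists>c. R h *v w j = c *s w j"
  shows "R h *v w j = basis_eigenvalue R w h j *s w j"
proof -
  obtain c where c: "R h *v w j = c *s w j" using assms(2) by blast
  have "basis_eigenvalue R w h j = c"
    unfolding basis_eigenvalue_def c using assms(1) by (simp add: onb_def)
  thus ?thesis using c by simp
qed

lemma basis_eigenvalue_unimodular:
  assumes on: "onb w" and ev: "\<exists>c. R h *v w j = c *s w j" and U: "unitary_mat (R h)"
  shows "cnj (basis_eigenvalue R w h j) * basis_eigenvalue R w h j = 1"
proof -
  have "adj (R h) ** R h = mat 1" using U by (simp add: unitary_mat_def)
  hence "cinner (R h *v w j) (R h *v w j) = cinner (w j) (w j)"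
    by (simp add: cinner_adj matrix_vector_mul_assoc)
  thus ?thesis
    unfolding basis_eigenvalue_eigenvector[of w R h j, OF on ev] using on
    by (simp add: onb_def mult.commute)
qed

lemma adj_basis_eigenvector:
  assumes on: "onb w" and ev: "\<exists>c. R h *v w j = c *s w j" and U: "unitary_mat (R h)"
  shows "adj (R h) *v w j = cnj (basis_eigenvalue R w h j) *s w j"
proof -
  let ?c = "basis_eigenvalue R w h j"
  have "adj (R h) ** R h = mat 1" using U by (simp add: unitary_mat_def)
  hence "w j = adj (R h) *v (R h *v w j)" by (simp add: matrix_vector_mul_assoc)
  also have "\<dots> = ?c *s (adj (R h) *v w j)"
    by (simp add: basis_eigenvalue_eigenvector[of w R h j, OF on ev] matrix_vector_mult_smult)
  finally have "cnj ?c *s w j = cnj ?c *s (?c *s (adj (R h) *v w j))" by (rule arg_cong)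
  also have "\<dots> = (cnj ?c * ?c) *s (adj (R h) *v w j)" by (rule vector_smult_assoc)
  finally show ?thesis using basis_eigenvalue_unimodular[of w R h j, OF on ev U] by simp
qed

lemma cinner_conj_action_basis:
  assumes on: "onb w" and evi: "\<exists>c. R h *v w i = c *s w i" and evj: "\<exists>c. R h *v w j = c *s w j"
    and U: "unitary_mat (R h)"
  shows "cinner (w i) (conj_action R h X *v w j)
       = basis_eigenvalue R w h i * cnj (basis_eigenvalue R w h j) * cinner (w i) (X *v w j)"
proof -
  have "cinner (w i) (R h *v y) = basis_eigenvalue R w h i * cinner (w i) y" for y
    using cinner_adj[of "adj (R h)" "w i" y]
    by (simp add: adj_basis_eigenvector[of w R h i, OF on evi U])
  moreover have "conj_action R h X *v w j = cnj (basis_eigenvalue R w h j) *s (R h *v (X *v w j))"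
    by (simp add: conj_action_def matrix_vector_mul_assoc[symmetric]
        adj_basis_eigenvector[of w R h j, OF on evj U] matrix_vector_mult_smult)
  ultimately show ?thesis by simp
qed

section \<open>Operators on a block that commute with \<open>R(H)\<close>\<close>

lemma cinner_block_space_eq_0:
  assumes "onb w" and "blk i \<noteq> k" and "y \<in> block_space w blk k"
  shows "cinner (w i) y = 0"
proof -
  have "vec.span (w ` {j. blk j = k}) \<subseteq> {y. cinner (w i) y = 0}"
  proof (rule vec.span_minimal)
    show "w ` {j. blk j = k} \<subseteq> {y. cinner (w i) y = 0}"
      using assms(1,2) by (auto simp: onb_def)
    show "vec.subspace {y. cinner (w i) y = 0}"
      by (auto simp: vec.subspace_def cinner_add_right)
  qed
  thus ?thesis using assms(3) unfolding block_space_def by auto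
qed

lemma End_block_diagonal_offdiag:
  assumes on: "onb w" and X: "X \<in> End_block w blk k" and d: "diagonal_in w blk k X"
    and "i \<noteq> j"
  shows "cinner (w i) (X *v w j) = 0"
proof (cases "blk j = k")
  case False
  thus ?thesis using X unfolding End_block_def by auto
next
  case True
  hence "w j \<in> block_space w blk k"
    unfolding block_space_def by (auto intro: vec.span_base)
  hence Xwj: "X *v w j \<in> block_space w blk k" using X unfolding End_block_def by auto
  show ?thesis
  proof (cases "blk i = k")
    case True
    thus ?thesis using d \<open>blk j = k\<close> \<open>i \<noteq> j\<close> unfolding diagonal_in_def by auto
  qed (rule cinner_block_space_eq_0[OF on _ Xwj])
qed

lemma End_block_diagonal_eigenvector:
  assumes on: "onb w" and X: "X \<in> End_block w blk k" and d: "diagonal_in w blk k X"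
  shows "X *v w j = cinner (w j) (X *v w j) *s w j"
proof -
  have "X *v w j = (\<Sum>i\<in>UNIV. cinner (w i) (X *v w j) *s w i)" by (rule onb_expansion[OF on])
  also have "\<dots> = (\<Sum>i\<in>UNIV. if i = j then cinner (w j) (X *v w j) *s w j else 0)"
    by (rule sum.cong) (auto simp: End_block_diagonal_offdiag[OF on X d])
  finally show ?thesis by simp
qed

lemma hs_inner_zero_diagonal_diagonal:
  assumes on: "onb w" and A: "A \<in> End_block w blk k" and B: "B \<in> End_block w blk k"
    and zA: "zero_diagonal_in w blk k A" and dB: "diagonal_in w blk k B"
  shows "hs_inner A B = 0"
proof -
  have "hs_inner A B = (\<Sum>j\<in>UNIV. cinner (A *v w j) (B *v w j))"
    unfolding hs_inner_def onb_trace[OF on] by (simp add: cinner_adj matrix_vector_mul_assoc)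
  also have "\<dots> = 0"
  proof (rule sum.neutral, rule ballI)
    fix j
    show "cinner (A *v w j) (B *v w j) = 0"
    proof (cases "blk j = k")
      case False
      thus ?thesis using B unfolding End_block_def by auto
    next
      case True
      hence "cinner (w j) (A *v w j) = 0" using zA unfolding zero_diagonal_in_def by auto
      hence "cinner (A *v w j) (w j) = 0" by (subst cinner_commute) simp
      thus ?thesis by (subst End_block_diagonal_eigenvector[OF on B dB]) simp
    qed
  qed
  finally show ?thesis .
qed

lemma diagonal_conj_action_fixed:
  assumes on: "onb w" and X: "X \<in> End_block w blk k" and d: "diagonal_in w blk k X"
    and ev: "\<And>j. \<exists>c. R h *v w j = c *s w j" and U: "unitary_mat (R h)"
  shows "conj_action R h X = X"
proof (rule onb_matrix_eqI[OF on])
  fix i j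
  have "cnj (basis_eigenvalue R w h j) * basis_eigenvalue R w h j = 1"
    by (rule basis_eigenvalue_unimodular[of w R h j, OF on ev U])
  thus "cinner (w i) (conj_action R h X *v w j) = cinner (w i) (X *v w j)"
    using End_block_diagonal_offdiag[OF on X d, of i j]
    by (cases "i = j") (simp_all add: cinner_conj_action_basis[of w R h, OF on ev ev U] mult.commute)
qed

lemma irreducible_eigenline:
  assumes on: "onb w" and ev: "\<And>h. h \<in> Hs \<Longrightarrow> \<exists>c. R h *v w i = c *s w i"
  shows "irreducible_submodule (*s) (\<lambda>g v. R g *v v) Hs (vec.span {w i})"
  unfolding irreducible_submodule_def
proof (intro conjI allI impI)
  show "invariant_subspace (*s) (\<lambda>g v. R g *v v) Hs (vec.span {w i})"
    unfolding invariant_subspace_def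
  proof (intro conjI ballI)
    fix h x assume h: "h \<in> Hs" and "x \<in> vec.span {w i}"
    then obtain c where "x = c *s w i" unfolding vec.span_singleton by auto
    hence "R h *v x = (c * basis_eigenvalue R w h i) *s w i"
      using basis_eigenvalue_eigenvector[of w R h i, OF on ev[OF h]]
      by (simp add: matrix_vector_mult_smult vector_smult_assoc)
    thus "R h *v x \<in> vec.span {w i}" unfolding vec.span_singleton by auto
  qed (rule vec.subspace_span)
  show "vec.span {w i} \<noteq> {0}"
    using onb_nonzero[OF on, of i] vec.span_base[of "w i" "{w i}"] by auto
  fix V assume V: "invariant_subspace (*s) (\<lambda>g v. R g *v v) Hs V \<and> V \<subseteq> vec.span {w i}"
  hence sV: "vec.subspace V" unfolding invariant_subspace_def by auto
  show "V = {0} \<or> V = vec.span {w i}"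
  proof (cases "V = {0}")
    case False
    then obtain v where v: "v \<in> V" "v \<noteq> 0" using vec.subspace_0[OF sV] by auto
    then obtain c where c: "v = c *s w i" using V unfolding vec.span_singleton by auto
    with v have "w i = inverse c *s v" by simp
    hence "w i \<in> V" using vec.subspace_scale[OF sV v(1)] by metis
    hence "vec.span {w i} \<subseteq> V" using vec.span_minimal[OF _ sV] by auto
    thus ?thesis using V by auto
  qed simp
qed

lemma isomorphic_eigenlines:
  assumes on: "onb w" and evi: "\<And>h. h \<in> Hs \<Longrightarrow> \<exists>c. R h *v w i = c *s w i"
    and evj: "\<And>h. h \<in> Hs \<Longrightarrow> \<exists>c. R h *v w j = c *s w j"
    and eq: "\<And>h. h \<in> Hs \<Longrightarrow> basis_eigenvalue R w h i = basis_eigenvalue R w h j"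
  shows "isomorphic_modules (*s) (\<lambda>g v. R g *v v) (vec.span {w i})
           (*s) (\<lambda>g v. R g *v v) (vec.span {w j}) Hs"
proof -
  define M where "M = (\<chi> a b. w j $ a * cnj (w i $ b))"
  have M: "M *v (c *s w i) = c *s w j" for c
  proof -
    have "M *v x = cinner (w i) x *s w j" for x
      by (simp add: M_def matrix_vector_mult_def cinner_def Finite_Cartesian_Product.vec_eq_iff
          sum_distrib_left algebra_simps)
    thus ?thesis using on by (simp add: onb_def)
  qed
  have M1: "M *v w i = w j" using M[of 1] by simp
  have "bij_betw ((*v) M) (vec.span {w i}) (vec.span {w j})"
    unfolding bij_betw_def
  proof
    show "inj_on ((*v) M) (vec.span {w i})"
      using onb_nonzero[OF on, of j]
      by (auto simp: inj_on_def vec.span_singleton M)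
    show "(*v) M ` vec.span {w i} = vec.span {w j}"
      unfolding vec.span_singleton by (auto simp: M image_iff)
  qed
  moreover have "M *v (R h *v x) = R h *v (M *v x)" if h: "h \<in> Hs" and "x \<in> vec.span {w i}" for h x
  proof -
    obtain c where x: "x = c *s w i" using \<open>x \<in> vec.span {w i}\<close> unfolding vec.span_singleton by auto
    have "M *v (R h *v x) = (c * basis_eigenvalue R w h i) *s w j"
      using basis_eigenvalue_eigenvector[of w R h i, OF on evi[OF h]]
      by (simp add: x matrix_vector_mult_smult vector_smult_assoc M M1)
    also have "\<dots> = R h *v (M *v x)"
      using basis_eigenvalue_eigenvector[of w R h j, OF on evj[OF h]] eq[OF h]
      by (simp add: x matrix_vector_mult_smult vector_smult_assoc M M1)
    finally show ?thesis .
  qed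
  ultimately show ?thesis
    unfolding isomorphic_modules_def using matrix_vector_mul_linear_gen[of M] by blast
qed

text \<open>Two basis vectors of the block on which \<open>H\<close> acts by the same character would span
  isomorphic \<open>H\<close>-submodules, contradicting multiplicity-freeness.\<close>

lemma conj_action_fixed_diagonal:
  assumes on: "onb w"
    and ev: "\<And>j h. h \<in> Hs \<Longrightarrow> \<exists>c. R h *v w j = c *s w j"
    and U: "\<And>h. unitary_mat (R h)"
    and mf: "multiplicity_free (*s) (\<lambda>g v. R g *v v) Hs (block_space w blk k)"
    and fixed: "\<And>h. h \<in> Hs \<Longrightarrow> conj_action R h X = X"
  shows "diagonal_in w blk k X"
  unfolding diagonal_in_def
proof (intro allI impI)
  fix i j assume ij: "blk i = k \<and> blk j = k \<and> i \<noteq> j"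
  show "cinner (w i) (X *v w j) = 0"
  proof (rule ccontr)
    assume X_ij: "cinner (w i) (X *v w j) \<noteq> 0"
    have same_character: "basis_eigenvalue R w h i = basis_eigenvalue R w h j" if h: "h \<in> Hs" for h
    proof -
      let ?ci = "basis_eigenvalue R w h i" and ?cj = "basis_eigenvalue R w h j"
      have "?ci * cnj ?cj = 1"
        using cinner_conj_action_basis[of w R h i j X, OF on ev[OF h] ev[OF h] U] fixed[OF h] X_ij
        by simp
      hence "?ci * (cnj ?cj * ?cj) = ?cj" by (simp add: mult.assoc[symmetric])
      thus ?thesis using basis_eigenvalue_unimodular[of w R h j, OF on ev[OF h] U] by simp
    qed
    have iso: "isomorphic_modules (*s) (\<lambda>g v. R g *v v) (vec.span {w i})
                 (*s) (\<lambda>g v. R g *v v) (vec.span {w j}) Hs"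
      by (rule isomorphic_eigenlines[of w Hs R i j, OF on]) (use ev same_character in auto)
    have sub: "vec.span {w l} \<subseteq> block_space w blk k" if "blk l = k" for l
      unfolding block_space_def using that by (intro vec.span_mono) auto
    have "vec.span {w i} = vec.span {w j}"
      by (rule mf[unfolded multiplicity_free_def, rule_format])
        (use ij iso sub irreducible_eigenline[of w Hs R, OF on ev] in auto)
    then obtain c where "w j = c *s w i"
      using vec.span_base[of "w j" "{w j}"] unfolding vec.span_singleton by auto
    hence "cinner (w j) (w j) = c * cinner (w j) (w i)" by simp
    thus False using on ij unfolding onb_def by auto
  qed
qed

lemma End_block_fixed_iff_diagonal:
  assumes on: "onb w"
    and ev: "\<And>j h. h \<in> Hs \<Longrightarrow> \<exists>c. R h *v w j = c *s w j"
    and U: "\<And>h. unitary_mat (R h)"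
    and mf: "multiplicity_free (*s) (\<lambda>g v. R g *v v) Hs (block_space w blk k)"
    and X: "X \<in> End_block w blk k"
  shows "(\<forall>h\<in>Hs. conj_action R h X = X) \<longleftrightarrow> diagonal_in w blk k X"
proof
  assume d: "diagonal_in w blk k X"
  show "\<forall>h\<in>Hs. conj_action R h X = X"
  proof
    fix h assume "h \<in> Hs"
    thus "conj_action R h X = X" by (intro diagonal_conj_action_fixed[OF on X d] ev U)
  qed
qed (use conj_action_fixed_diagonal[OF on ev U mf] in blast)

section \<open>Hilbert-Schmidt orthonormal bases of operator spaces\<close>

definition hs_onb :: "('s::finite \<Rightarrow> complex^'n^'n) \<Rightarrow> (complex^'n^'n) set \<Rightarrow> bool" where
  "hs_onb e E \<longleftrightarrow> (\<forall>\<sigma> \<tau>. hs_inner (e \<sigma>) (e \<tau>) = (if \<sigma> = \<tau> then 1 else 0)) \<and>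
     module.span mscale (range e) = E"

lemma hs_onb_inj: "hs_onb e E \<Longrightarrow> inj e"
  unfolding hs_onb_def inj_def by (metis zero_neq_one)

lemma hs_onb_in: "hs_onb e E \<Longrightarrow> e \<sigma> \<in> E"
  unfolding hs_onb_def using module.span_base[OF module_mscale] by blast

lemma hs_onb_combination_in:
  assumes "hs_onb e E"
  shows "(\<Sum>\<sigma>\<in>S. mscale (c \<sigma>) (e \<sigma>)) \<in> E"
proof -
  interpret M: Modules.module mscale by (rule module_mscale)
  have "(\<Sum>\<sigma>\<in>S. mscale (c \<sigma>) (e \<sigma>)) \<in> M.span (range e)"
    by (intro M.span_sum M.span_scale M.span_base) auto
  thus ?thesis using assms unfolding hs_onb_def by simp
qed

lemma hs_onb_coefficient:
  "hs_onb e E \<Longrightarrow> hs_inner (e \<alpha>) (\<Sum>\<sigma>\<in>UNIV. mscale (c \<sigma>) (e \<sigma>)) = c \<alpha>"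
  unfolding hs_onb_def by (simp add: hs_inner_sum_right)

lemma hs_onb_expansion:
  assumes h: "hs_onb e E" and X: "X \<in> E"
  shows "X = (\<Sum>\<sigma>\<in>UNIV. mscale (hs_inner (e \<sigma>) X) (e \<sigma>))"
proof -
  interpret M: Modules.module mscale by (rule module_mscale)
  have "X \<in> M.span (range e)" using h X unfolding hs_onb_def by simp
  then obtain u where "X = (\<Sum>v\<in>range e. mscale (u v) v)"
    using M.span_finite[of "range e"] by auto
  hence X_eq: "X = (\<Sum>\<sigma>\<in>UNIV. mscale (u (e \<sigma>)) (e \<sigma>))"
    using sum.reindex[OF hs_onb_inj[OF h], of "\<lambda>v. mscale (u v) v"] by simp
  have "hs_inner (e \<alpha>) X = u (e \<alpha>)" for \<alpha>
    unfolding X_eq by (rule hs_onb_coefficient[OF h])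
  thus ?thesis using X_eq by simp
qed

lemma hs_onb_parseval:
  assumes h: "hs_onb e E" and X: "X \<in> E" and Y: "Y \<in> E"
  shows "hs_inner X Y = (\<Sum>\<alpha>\<in>UNIV. cnj (hs_inner (e \<alpha>) X) * hs_inner (e \<alpha>) Y)"
proof -
  have "hs_inner X Y = (\<Sum>\<alpha>\<in>UNIV. hs_inner (e \<alpha>) Y * hs_inner X (e \<alpha>))"
    by (subst hs_onb_expansion[OF h Y]) (simp add: hs_inner_sum_right)
  thus ?thesis by (simp add: hs_inner_commute[of X] mult.commute)
qed

section \<open>Counting basis elements through an intertwiner\<close>

lemma linear_bij_preimage_basis:
  fixes T :: "complex^'d \<Rightarrow> complex^'n^'n" and e :: "'s::finite \<Rightarrow> complex^'n^'n"
  assumes h: "hs_onb e E" and lin: "Vector_Spaces.linear (*s) mscale T"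
    and bij: "bij_betw T UNIV E"
  obtains f where "\<And>\<sigma>. T (f \<sigma>) = e \<sigma>" and "inj f" and "vec.independent (range f)"
    and "\<And>x. (\<Sum>\<sigma>\<in>UNIV. hs_inner (e \<sigma>) (T x) *s f \<sigma>) = x"
proof -
  interpret T: Vector_Spaces.linear "(*s)" mscale T by (rule lin)
  define f where "f \<sigma> = inv_into UNIV T (e \<sigma>)" for \<sigma>
  have Tf: "T (f \<sigma>) = e \<sigma>" for \<sigma>
    unfolding f_def using bij hs_onb_in[OF h] by (simp add: bij_betw_inv_into_right)
  have T_combination: "T (\<Sum>\<sigma>\<in>S. c \<sigma> *s f \<sigma>) = (\<Sum>\<sigma>\<in>S. mscale (c \<sigma>) (e \<sigma>))" for S c
    by (simp add: T.sum T.scale Tf)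
  have inj: "inj f" using hs_onb_inj[OF h] Tf unfolding inj_def by metis
  have ind: "vec.independent (range f)"
  proof
    assume "vec.dependent (range f)"
    then obtain u where u: "\<exists>v\<in>range f. u v \<noteq> 0" "(\<Sum>v\<in>range f. u v *s v) = 0"
      using vec.dependent_finite[of "range f"] by auto
    have "(\<Sum>\<sigma>\<in>UNIV. u (f \<sigma>) *s f \<sigma>) = 0"
      using u(2) sum.reindex[OF inj, of "\<lambda>v. u v *s v"] by simp
    hence "(\<Sum>\<sigma>\<in>UNIV. mscale (u (f \<sigma>)) (e \<sigma>)) = 0"
      by (metis T_combination T.zero)
    hence "u (f \<alpha>) = 0" for \<alpha>
      using hs_onb_coefficient[OF h, of \<alpha> "\<lambda>\<sigma>. u (f \<sigma>)"] by simp
    with u(1) show False by auto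
  qed
  have expansion: "(\<Sum>\<sigma>\<in>UNIV. hs_inner (e \<sigma>) (T x) *s f \<sigma>) = x" for x
  proof (rule bij_betw_imp_inj_on[OF bij, THEN injD])
    have "T x \<in> E" using bij by (auto simp: bij_betw_def)
    thus "T (\<Sum>\<sigma>\<in>UNIV. hs_inner (e \<sigma>) (T x) *s f \<sigma>) = T x"
      unfolding T_combination by (rule hs_onb_expansion[OF h, symmetric])
  qed
  show thesis by (rule that[OF Tf inj ind expansion])
qed

lemma card_hs_onb_eq_dim:
  fixes T :: "complex^'d \<Rightarrow> complex^'n^'n" and e :: "'s::finite \<Rightarrow> complex^'n^'n"
  assumes "hs_onb e E" and "Vector_Spaces.linear (*s) mscale T" and "bij_betw T UNIV E"
  shows "CARD('s) = CARD('d)"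
proof -
  obtain f where "\<And>\<sigma>. T (f \<sigma>) = e \<sigma>" and inj: "inj f" and ind: "vec.independent (range f)"
    and expansion: "\<And>x. (\<Sum>\<sigma>\<in>UNIV. hs_inner (e \<sigma>) (T x) *s f \<sigma>) = x"
    using linear_bij_preimage_basis[OF assms] by blast
  have "x \<in> vec.span (range f)" for x
    by (subst expansion[of x, symmetric]) (intro vec.span_sum vec.span_scale vec.span_base, auto)
  hence "vec.span (range f) = UNIV" by auto
  have "CARD('d) = vec.dim (UNIV :: (complex^'d) set)" by (rule vec_dim_card[symmetric])
  also have "\<dots> = vec.dim (range f)"
    using \<open>vec.span (range f) = UNIV\<close> vec.dim_span[of "range f"] by simp
  also have "\<dots> = CARD('s)"
    using vec.dim_eq_card_independent[OF ind] inj by (simp add: card_image)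
  finally show ?thesis by simp
qed

text \<open>The preimages under \<open>T\<close> of the basis elements with \<open>P\<close> form a basis of the
  \<open>H\<close>-fixed vectors of \<open>\<rho>\<close>.\<close>

lemma card_fixed_basis_elements:
  fixes T :: "complex^'d \<Rightarrow> complex^'n^'n" and e :: "'s::finite \<Rightarrow> complex^'n^'n"
  assumes h: "hs_onb e E" and lin: "Vector_Spaces.linear (*s) mscale T"
    and bij: "bij_betw T UNIV E"
    and intertwines: "\<And>g x. T (\<rho> g *v x) = conj_action R g (T x)"
    and fixed_iff: "\<And>X. X \<in> E \<Longrightarrow> (\<forall>h\<in>Hs. conj_action R h X = X) \<longleftrightarrow> P X"
    and orth: "\<And>\<sigma> X. X \<in> E \<Longrightarrow> P X \<Longrightarrow> \<not> P (e \<sigma>) \<Longrightarrow> hs_inner (e \<sigma>) X = 0"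
  shows "card {\<sigma>. P (e \<sigma>)} = fixed_dim \<rho> Hs"
proof -
  obtain f where Tf: "\<And>\<sigma>. T (f \<sigma>) = e \<sigma>" and inj: "inj f" and ind: "vec.independent (range f)"
    and expansion: "\<And>x. (\<Sum>\<sigma>\<in>UNIV. hs_inner (e \<sigma>) (T x) *s f \<sigma>) = x"
    using linear_bij_preimage_basis[OF h lin bij] by blast
  define D where "D = {\<sigma>. P (e \<sigma>)}"
  define F where "F = {v :: complex^'d. \<forall>h\<in>Hs. \<rho> h *v v = v}"
  have F_iff: "v \<in> F \<longleftrightarrow> P (T v)" for v
  proof -
    have "inj T" using bij by (simp add: bij_betw_def)
    hence "v \<in> F \<longleftrightarrow> (\<forall>h\<in>Hs. conj_action R h (T v) = T v)"
      unfolding F_def intertwines[symmetric] by (auto dest: injD)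
    also have "\<dots> \<longleftrightarrow> P (T v)" using bij by (intro fixed_iff) (auto simp: bij_betw_def)
    finally show ?thesis .
  qed
  have "F = vec.span (f ` D)"
  proof
    show "F \<subseteq> vec.span (f ` D)"
    proof
      fix v assume "v \<in> F"
      hence "hs_inner (e \<sigma>) (T v) = 0" if "\<sigma> \<notin> D" for \<sigma>
        using orth that bij F_iff unfolding D_def bij_betw_def by auto
      hence "v = (\<Sum>\<sigma>\<in>D. hs_inner (e \<sigma>) (T v) *s f \<sigma>)"
        by (subst expansion[symmetric], intro sum.mono_neutral_right) auto
      also have "\<dots> \<in> vec.span (f ` D)"
        by (intro vec.span_sum vec.span_scale vec.span_base) auto
      finally show "v \<in> vec.span (f ` D)" .
    qed
    have "vec.subspace F"
      unfolding F_def vec.subspace_def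
      by (auto simp: matrix_vector_right_distrib matrix_vector_mult_smult)
    moreover have "f ` D \<subseteq> F" using F_iff Tf unfolding D_def by auto
    ultimately show "vec.span (f ` D) \<subseteq> F" by (rule vec.span_minimal[rotated])
  qed
  hence "fixed_dim \<rho> Hs = vec.dim (f ` D)" unfolding fixed_dim_def F_def by simp
  also have "\<dots> = card (f ` D)"
    using vec.dim_eq_card_independent[OF vec.independent_mono[OF ind, of "f ` D"]] by auto
  also have "\<dots> = card D" using inj by (simp add: card_image inj_on_subset)
  finally show ?thesis unfolding D_def by simp
qed

lemma card_diagonal_eq_fixed_dim:
  fixes T :: "complex^'d \<Rightarrow> complex^'n^'n" and e :: "'s::finite \<Rightarrow> complex^'n^'n"
  assumes W: "NDCSE R Hs w blk" and k0: "k0 \<in> range blk" and U: "\<And>h. unitary_mat (R h)"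
    and E_sub: "E \<subseteq> End_block w blk k0" and e: "hs_onb e E"
    and e_diag: "\<And>\<sigma>. diagonal_in w blk k0 (e \<sigma>) \<or> zero_diagonal_in w blk k0 (e \<sigma>)"
    and lin: "Vector_Spaces.linear (*s) mscale T" and bij: "bij_betw T UNIV E"
    and intertwines: "\<And>g x. T (\<rho> g *v x) = conj_action R g (T x)"
  shows "card {\<sigma>. diagonal_in w blk k0 (e \<sigma>)} = fixed_dim \<rho> Hs"
proof (rule card_fixed_basis_elements[OF e lin bij intertwines])
  have on: "onb w" using W unfolding NDCSE_def onb_def by blast
  have ev: "\<And>j h. h \<in> Hs \<Longrightarrow> \<exists>c. R h *v w j = c *s w j"
    using W unfolding NDCSE_def by blast
  have mf: "multiplicity_free (*s) (\<lambda>g v. R g *v v) Hs (block_space w blk k0)"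
    using W k0 unfolding NDCSE_def by blast
  show "(\<forall>h\<in>Hs. conj_action R h X = X) \<longleftrightarrow> diagonal_in w blk k0 X" if "X \<in> E" for X
    using E_sub \<open>X \<in> E\<close> by (intro End_block_fixed_iff_diagonal[OF on ev U mf]) auto
  show "hs_inner (e \<sigma>) X = 0" if X: "X \<in> E" and "diagonal_in w blk k0 X"
    and "\<not> diagonal_in w blk k0 (e \<sigma>)" for \<sigma> X
  proof (rule hs_inner_zero_diagonal_diagonal[OF on _ _ _ \<open>diagonal_in w blk k0 X\<close>])
    show "e \<sigma> \<in> End_block w blk k0" "X \<in> End_block w blk k0"
      using E_sub hs_onb_in[OF e] X by auto
    show "zero_diagonal_in w blk k0 (e \<sigma>)"
      using e_diag \<open>\<not> diagonal_in w blk k0 (e \<sigma>)\<close> by blast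
  qed
qed

section \<open>Schur orthogonality\<close>

definition hs_coords :: "('s::finite \<Rightarrow> complex^'n^'n) \<Rightarrow> complex^'n^'n \<Rightarrow> complex^'s" where
  "hs_coords e X = (\<chi> \<alpha>. hs_inner (e \<alpha>) X)"

definition coeff_matrix ::
  "('s::finite \<Rightarrow> complex^'n^'n) \<Rightarrow> ('g \<Rightarrow> complex^'n^'n) \<Rightarrow> 'g \<Rightarrow> complex^'s^'s" where
  "coeff_matrix e R g = (\<chi> \<alpha> \<beta>. hs_inner (e \<alpha>) (conj_action R g (e \<beta>)))"

lemma coeff_matrix_component:
  "coeff_matrix e R g $ \<sigma> $ \<tau> = trace (adj (e \<sigma>) ** R g ** e \<tau> ** adj (R g))"
  by (simp add: coeff_matrix_def trace_adj_conj_action)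

lemma hs_coords_add: "hs_coords e (X + Y) = hs_coords e X + hs_coords e Y"
  by (simp add: hs_coords_def Finite_Cartesian_Product.vec_eq_iff hs_inner_add_right)

lemma hs_coords_mscale: "hs_coords e (mscale c X) = c *s hs_coords e X"
  by (simp add: hs_coords_def Finite_Cartesian_Product.vec_eq_iff)

lemma hs_coords_zero [simp]: "hs_coords e 0 = 0"
  by (simp add: hs_coords_def Finite_Cartesian_Product.vec_eq_iff)

lemma hs_coords_combination:
  "hs_onb e E \<Longrightarrow> hs_coords e (\<Sum>\<beta>\<in>UNIV. mscale (v $ \<beta>) (e \<beta>)) = v"
  by (simp add: hs_coords_def hs_onb_coefficient Finite_Cartesian_Product.vec_eq_iff)

lemma hs_coords_basis: "hs_onb e E \<Longrightarrow> hs_coords e (e \<gamma>) = axis \<gamma> 1"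
  by (simp add: hs_coords_def hs_onb_def axis_def Finite_Cartesian_Product.vec_eq_iff)

lemma hs_coords_conj_action:
  assumes "hs_onb e E" and "X \<in> E"
  shows "hs_coords e (conj_action R g X) = coeff_matrix e R g *v hs_coords e X"
proof -
  have "hs_inner (e \<alpha>) (conj_action R g X)
      = (\<Sum>\<beta>\<in>UNIV. hs_inner (e \<alpha>) (conj_action R g (e \<beta>)) * hs_inner (e \<beta>) X)" for \<alpha>
    by (subst hs_onb_expansion[OF assms])
      (simp add: conj_action_sum conj_action_mscale hs_inner_sum_right mult.commute)
  thus ?thesis
    by (simp add: hs_coords_def coeff_matrix_def matrix_vector_mult_def
        Finite_Cartesian_Product.vec_eq_iff)
qed

lemma coeff_matrix_mult:
  assumes h: "hs_onb e E" and inv: "\<And>X. X \<in> E \<Longrightarrow> conj_action R g' X \<in> E"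
    and mult: "R (mul g g') = R g ** R g'"
  shows "coeff_matrix e R (mul g g') = coeff_matrix e R g ** coeff_matrix e R g'"
proof -
  have "hs_coords e (conj_action R (mul g g') (e \<beta>))
      = coeff_matrix e R g *v hs_coords e (conj_action R g' (e \<beta>))" for \<beta>
    unfolding conj_action_mult[of R mul g g', OF mult]
    by (rule hs_coords_conj_action[OF h inv[OF hs_onb_in[OF h]]])
  thus ?thesis
    by (simp add: hs_coords_def coeff_matrix_def matrix_vector_mult_def matrix_matrix_mult_def
        Finite_Cartesian_Product.vec_eq_iff)
qed

lemma coeff_matrix_unitary:
  assumes h: "hs_onb e E" and inv: "\<And>X. X \<in> E \<Longrightarrow> conj_action R g X \<in> E"
    and U: "unitary_mat (R g)"
  shows "adj (coeff_matrix e R g) ** coeff_matrix e R g = mat 1"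
proof -
  have "(adj (coeff_matrix e R g) ** coeff_matrix e R g) $ \<gamma> $ \<delta>
      = hs_inner (conj_action R g (e \<gamma>)) (conj_action R g (e \<delta>))" for \<gamma> \<delta>
    by (simp add: adj_def matrix_matrix_mult_def coeff_matrix_def
        hs_onb_parseval[OF h inv[OF hs_onb_in[OF h]] inv[OF hs_onb_in[OF h]]])
  thus ?thesis
    using h by (simp add: hs_inner_conj_action[of R g, OF U] hs_onb_def Finite_Cartesian_Product.vec_eq_iff
        Finite_Cartesian_Product.mat_def)
qed

lemma coeff_matrix_column_norm:
  assumes "hs_onb e E" and "\<And>X. X \<in> E \<Longrightarrow> conj_action R g X \<in> E" and "unitary_mat (R g)"
  shows "(\<Sum>\<alpha>\<in>UNIV. (cmod (coeff_matrix e R g $ \<alpha> $ \<beta>))\<^sup>2) = 1"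
proof -
  have "(\<Sum>\<alpha>\<in>UNIV. cnj (coeff_matrix e R g $ \<alpha> $ \<beta>) * coeff_matrix e R g $ \<alpha> $ \<beta>) = 1"
    using arg_cong[OF coeff_matrix_unitary[OF assms], of "\<lambda>M. M $ \<beta> $ \<beta>"]
    by (simp add: adj_def matrix_matrix_mult_def Finite_Cartesian_Product.mat_def)
  hence "(\<Sum>\<alpha>\<in>UNIV. complex_of_real ((cmod (coeff_matrix e R g $ \<alpha> $ \<beta>))\<^sup>2)) = 1"
    by (simp only: complex_norm_square mult.commute)
  thus ?thesis by (simp only: of_real_sum[symmetric] of_real_eq_1_iff)
qed

lemma norm_coeff_matrix_le_1:
  assumes "hs_onb e E" and "\<And>X. X \<in> E \<Longrightarrow> conj_action R g X \<in> E" and "unitary_mat (R g)"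
  shows "cmod (coeff_matrix e R g $ \<alpha> $ \<beta>) \<le> 1"
proof -
  have "(cmod (coeff_matrix e R g $ \<alpha> $ \<beta>))\<^sup>2 \<le> 1"
    using member_le_sum[of \<alpha> UNIV "\<lambda>\<alpha>. (cmod (coeff_matrix e R g $ \<alpha> $ \<beta>))\<^sup>2"]
      coeff_matrix_column_norm[OF assms, of \<beta>] by simp
  thus ?thesis using power2_le_imp_le[of _ 1] by simp
qed

lemma continuous_on_coeff_matrix:
  assumes "cont_unitary_rep mul z R"
  shows "continuous_on UNIV (\<lambda>g. coeff_matrix e R g $ \<alpha> $ \<beta>)"
proof -
  have R: "continuous_on UNIV (\<lambda>g. R g $ i $ j)" for i j
    using assms unfolding cont_unitary_rep_def by blast
  have "(\<lambda>g. coeff_matrix e R g $ \<alpha> $ \<beta>) = (\<lambda>g. \<Sum>i\<in>UNIV. \<Sum>j\<in>UNIV. cnj (e \<alpha> $ i $ j) *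
      (\<Sum>l\<in>UNIV. (\<Sum>k\<in>UNIV. R g $ i $ k * e \<beta> $ k $ l) * cnj (R g $ j $ l)))"
    by (simp add: coeff_matrix_def hs_inner_eq_sum conj_action_component)
  thus ?thesis by (simp only:) (intro continuous_intros R)
qed

lemma mat_eqI_axis_eigenvectors:
  fixes M :: "'a::comm_ring_1^'n^'n"
  assumes "\<And>\<gamma>. M *v axis \<gamma> 1 = l *s axis \<gamma> 1"
  shows "M = mat l"
proof -
  have "M $ \<alpha> $ \<gamma> = mat l $ \<alpha> $ \<gamma>" for \<alpha> \<gamma>
    using arg_cong[OF assms[of \<gamma>], of "\<lambda>v. v $ \<alpha>"]
    by (simp add: matrix_vector_mult_def axis_def Finite_Cartesian_Product.mat_def)
  thus ?thesis by (simp add: Finite_Cartesian_Product.vec_eq_iff)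
qed

lemma invariant_subspace_coeff_eigenspace:
  assumes h: "hs_onb e E" and E: "invariant_subspace mscale (conj_action R) UNIV E"
    and comm: "\<And>g. M ** coeff_matrix e R g = coeff_matrix e R g ** M"
  shows "invariant_subspace mscale (conj_action R) UNIV
           {X \<in> E. M *v hs_coords e X = l *s hs_coords e X}" (is "invariant_subspace _ _ _ ?V")
  unfolding invariant_subspace_def
proof (intro conjI ballI)
  interpret Mod: Modules.module mscale by (rule module_mscale)
  have E_sub: "Mod.subspace E" and E_inv: "\<And>g X. X \<in> E \<Longrightarrow> conj_action R g X \<in> E"
    using E unfolding invariant_subspace_def by blast+
  show "Mod.subspace ?V"
  proof (rule Mod.subspaceI)
    show "0 \<in> ?V" using Mod.subspace_0[OF E_sub] by simp
    show "X + Y \<in> ?V" if "X \<in> ?V" "Y \<in> ?V" for X Y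
      using that Mod.subspace_add[OF E_sub]
      by (simp add: hs_coords_add matrix_vector_right_distrib vector_add_ldistrib)
    show "mscale c X \<in> ?V" if "X \<in> ?V" for c X
      using that Mod.subspace_scale[OF E_sub]
      by (auto simp: hs_coords_mscale matrix_vector_mult_smult vector_smult_assoc mult.commute)
  qed
  fix g X assume "X \<in> ?V"
  hence X: "X \<in> E" "M *v hs_coords e X = l *s hs_coords e X" by auto
  have "M *v hs_coords e (conj_action R g X) = coeff_matrix e R g *v (M *v hs_coords e X)"
    by (simp add: hs_coords_conj_action[OF h X(1)] matrix_vector_mul_assoc comm)
  also have "\<dots> = l *s hs_coords e (conj_action R g X)"
    by (simp add: X(2) hs_coords_conj_action[OF h X(1)] matrix_vector_mult_smult)
  finally show "conj_action R g X \<in> ?V" using E_inv[OF X(1)] by simp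
qed

text \<open>Schur's lemma in coordinates: an eigenspace of \<open>M\<close>, read through the coordinates,
  is a nonzero invariant subspace of \<open>E\<close>, hence all of \<open>E\<close>.\<close>

lemma commuting_coeff_matrix_scalar:
  assumes h: "hs_onb e E" and irr: "irreducible_submodule mscale (conj_action R) UNIV E"
    and comm: "\<And>g. M ** coeff_matrix e R g = coeff_matrix e R g ** M"
  obtains l where "M = mat l"
proof -
  obtain v l where v: "v \<noteq> 0" and eig: "M *v v = l *s v"
    by (rule complex_matrix_has_eigenvector)
  define V where "V = {X \<in> E. M *v hs_coords e X = l *s hs_coords e X}"
  have E: "invariant_subspace mscale (conj_action R) UNIV E"
    using irr unfolding irreducible_submodule_def by blast
  define X0 where "X0 = (\<Sum>\<beta>\<in>UNIV. mscale (v $ \<beta>) (e \<beta>))"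
  have X0_coords: "hs_coords e X0 = v" unfolding X0_def by (rule hs_coords_combination[OF h])
  have "X0 \<in> E" unfolding X0_def by (rule hs_onb_combination_in[OF h])
  hence "X0 \<in> V" unfolding V_def using X0_coords eig by simp
  moreover have "X0 \<noteq> 0" using X0_coords v by auto
  moreover have "V \<subseteq> E" unfolding V_def by auto
  ultimately have "V = E"
    using irr invariant_subspace_coeff_eigenspace[OF h E comm, of l]
    unfolding irreducible_submodule_def V_def by blast
  have "M *v axis \<gamma> 1 = l *s axis \<gamma> 1" for \<gamma>
  proof -
    have "e \<gamma> \<in> V" using \<open>V = E\<close> hs_onb_in[OF h] by simp
    thus ?thesis unfolding V_def by (simp add: hs_coords_basis[OF h])
  qed
  thus thesis by (intro that mat_eqI_axis_eigenvectors)
qed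

text \<open>\<open>A\<close> is the Haar average of \<open>\<lambda>(g) P\<^sub>\<tau> \<lambda>(g)\<^sup>\<dagger>\<close>, where \<open>P\<^sub>\<tau>\<close> projects onto the
  \<open>\<tau>\<close>-th coordinate; it commutes with \<open>\<lambda>(g')\<close> by left invariance of the Haar measure.\<close>

lemma coeff_column_gram_commutes:
  fixes R :: "'g::t2_space \<Rightarrow> complex^'n^'n" and e :: "'s::finite \<Rightarrow> complex^'n^'n" and \<tau> :: 's
  assumes G: "compact_group mul z iv" and haar: "normalized_haar mul \<mu>"
    and rep: "cont_unitary_rep mul z R" and h: "hs_onb e E"
    and inv: "\<And>g X. X \<in> E \<Longrightarrow> conj_action R g X \<in> E"
  defines "A \<equiv> \<chi> \<alpha> \<beta>. \<integral>g. coeff_matrix e R g $ \<alpha> $ \<tau> * cnj (coeff_matrix e R g $ \<beta> $ \<tau>) \<partial>\<mu>"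
  shows "A ** coeff_matrix e R g' = coeff_matrix e R g' ** A"
proof -
  let ?U = "coeff_matrix e R"
  have R_mult: "R (mul g g') = R g ** R g'" and U: "unitary_mat (R g)" for g g'
    using rep unfolding cont_unitary_rep_def by auto
  have cont: "continuous_on UNIV (\<lambda>g. ?U g $ \<alpha> $ \<tau> * cnj (?U g $ \<beta> $ \<tau>))" for \<alpha> \<beta>
    by (intro continuous_on_mult continuous_on_cnj continuous_on_coeff_matrix[OF rep])
  have integrable: "integrable \<mu> (\<lambda>g. ?U g $ \<alpha> $ \<tau> * cnj (?U g $ \<beta> $ \<tau>))" for \<alpha> \<beta>
    by (rule integrable_haar_bounded_continuous[OF haar cont, where B = 1])
      (simp add: norm_mult mult_le_one norm_coeff_matrix_le_1[OF h inv U])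
  have column: "?U (mul g' g) $ \<alpha> $ \<tau> = (\<Sum>\<gamma>\<in>UNIV. ?U g' $ \<alpha> $ \<gamma> * ?U g $ \<gamma> $ \<tau>)" for \<alpha> g
  proof -
    have "?U (mul g' g) = ?U g' ** ?U g" by (intro coeff_matrix_mult[where E = E] h inv R_mult)
    thus ?thesis by (simp only: matrix_matrix_mult_def vec_lambda_beta)
  qed
  have average: "A $ \<alpha> $ \<beta> =
      (\<Sum>\<gamma>\<in>UNIV. \<Sum>\<delta>\<in>UNIV. (?U g' $ \<alpha> $ \<gamma> * cnj (?U g' $ \<beta> $ \<delta>)) * A $ \<gamma> $ \<delta>)" for \<alpha> \<beta>
  proof -
    have "A $ \<alpha> $ \<beta> = (\<integral>g. ?U (mul g' g) $ \<alpha> $ \<tau> * cnj (?U (mul g' g) $ \<beta> $ \<tau>) \<partial>\<mu>)"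
      unfolding A_def
      using integral_haar_mul_left[OF G haar borel_measurable_continuous_onI[OF cont]] by simp
    also have "\<dots> = (\<integral>g. (\<Sum>\<gamma>\<in>UNIV. \<Sum>\<delta>\<in>UNIV. (?U g' $ \<alpha> $ \<gamma> * cnj (?U g' $ \<beta> $ \<delta>)) *
                        (?U g $ \<gamma> $ \<tau> * cnj (?U g $ \<delta> $ \<tau>))) \<partial>\<mu>)"
      unfolding column by (simp only: cnj_sum complex_cnj_mult sum_product mult_ac)
    also have "\<dots> = (\<Sum>\<gamma>\<in>UNIV. \<Sum>\<delta>\<in>UNIV. (?U g' $ \<alpha> $ \<gamma> * cnj (?U g' $ \<beta> $ \<delta>)) * A $ \<gamma> $ \<delta>)"
      unfolding A_def vec_lambda_beta
      by (simp add: Bochner_Integration.integral_sum integrable integrable_sum)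
    finally show ?thesis .
  qed
  have "(?U g' ** A ** adj (?U g')) $ \<alpha> $ \<beta> = A $ \<alpha> $ \<beta>" for \<alpha> \<beta>
  proof -
    have "(?U g' ** A ** adj (?U g')) $ \<alpha> $ \<beta>
        = (\<Sum>\<delta>\<in>UNIV. \<Sum>\<gamma>\<in>UNIV. (?U g' $ \<alpha> $ \<gamma> * cnj (?U g' $ \<beta> $ \<delta>)) * A $ \<gamma> $ \<delta>)"
      by (simp add: matrix_matrix_mult_def adj_def sum_distrib_left sum_distrib_right algebra_simps)
    also have "\<dots> = A $ \<alpha> $ \<beta>" by (subst sum.swap) (rule average[symmetric])
    finally show ?thesis .
  qed
  hence "A = ?U g' ** A ** adj (?U g')" by (simp add: Finite_Cartesian_Product.vec_eq_iff)
  hence "A ** ?U g' = ?U g' ** A ** (adj (?U g') ** ?U g')" by (simp add: matrix_mul_assoc)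
  thus ?thesis by (simp add: coeff_matrix_unitary[OF h inv U])
qed

lemma schur_orthogonality:
  fixes R :: "'g::t2_space \<Rightarrow> complex^'n^'n" and e :: "'s::finite \<Rightarrow> complex^'n^'n"
  assumes G: "compact_group mul z iv" and haar: "normalized_haar mul \<mu>"
    and rep: "cont_unitary_rep mul z R" and h: "hs_onb e E"
    and irr: "irreducible_submodule mscale (conj_action R) UNIV E"
  shows "integrable \<mu> (\<lambda>g. (cmod (coeff_matrix e R g $ \<sigma> $ \<tau>))\<^sup>2)"
    and "(\<integral>g. (cmod (coeff_matrix e R g $ \<sigma> $ \<tau>))\<^sup>2 \<partial>\<mu>) = 1 / real CARD('s)"
proof -
  let ?U = "coeff_matrix e R"
  define I where "I \<alpha> = (\<integral>g. (cmod (?U g $ \<alpha> $ \<tau>))\<^sup>2 \<partial>\<mu>)" for \<alpha>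
  have inv: "\<And>g X. X \<in> E \<Longrightarrow> conj_action R g X \<in> E"
    using irr unfolding irreducible_submodule_def invariant_subspace_def by blast
  have U: "unitary_mat (R g)" for g using rep unfolding cont_unitary_rep_def by blast
  have cont: "continuous_on UNIV (\<lambda>g. (cmod (?U g $ \<alpha> $ \<tau>))\<^sup>2)" for \<alpha>
    by (intro continuous_on_power continuous_on_norm continuous_on_coeff_matrix[OF rep])
  have integrable: "integrable \<mu> (\<lambda>g. (cmod (?U g $ \<alpha> $ \<tau>))\<^sup>2)" for \<alpha>
    by (rule integrable_haar_bounded_continuous[OF haar cont, where B = 1])
      (simp add: power_le_one norm_coeff_matrix_le_1[OF h inv U])
  thus "integrable \<mu> (\<lambda>g. (cmod (?U g $ \<sigma> $ \<tau>))\<^sup>2)" .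
  define A where "A = (\<chi> \<alpha> \<beta>. \<integral>g. ?U g $ \<alpha> $ \<tau> * cnj (?U g $ \<beta> $ \<tau>) \<partial>\<mu>)"
  obtain l where A_scalar: "A = mat l"
    using commuting_coeff_matrix_scalar[OF h irr coeff_column_gram_commutes[OF G haar rep h inv]]
    unfolding A_def by blast
  have "complex_of_real (I \<alpha>) = A $ \<alpha> $ \<alpha>" for \<alpha>
  proof -
    have "complex_of_real (I \<alpha>) = (\<integral>g. complex_of_real ((cmod (?U g $ \<alpha> $ \<tau>))\<^sup>2) \<partial>\<mu>)"
      unfolding I_def by (rule integral_complex_of_real[symmetric])
    also have "\<dots> = A $ \<alpha> $ \<alpha>" by (simp only: A_def vec_lambda_beta complex_norm_square)
    finally show ?thesis .
  qed
  hence of_real_I: "complex_of_real (I \<alpha>) = l" for \<alpha>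
    unfolding A_scalar by (simp add: Finite_Cartesian_Product.mat_def)
  have "complex_of_real (real CARD('s) * I \<sigma>) = complex_of_real (\<Sum>\<alpha>\<in>UNIV. I \<alpha>)"
    by (simp add: of_real_I)
  hence "real CARD('s) * I \<sigma> = (\<Sum>\<alpha>\<in>UNIV. I \<alpha>)" by (simp only: of_real_eq_iff)
  also have "\<dots> = (\<integral>g. (\<Sum>\<alpha>\<in>UNIV. (cmod (?U g $ \<alpha> $ \<tau>))\<^sup>2) \<partial>\<mu>)"
    unfolding I_def by (rule Bochner_Integration.integral_sum[symmetric]) (rule integrable)
  also have "\<dots> = 1"
    by (simp add: coeff_matrix_column_norm[OF h inv U] normalized_haar_measure_space[OF haar])
  finally have "real CARD('s) * I \<sigma> = 1" .
  thus "(\<integral>g. (cmod (?U g $ \<sigma> $ \<tau>))\<^sup>2 \<partial>\<mu>) = 1 / real CARD('s)"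
    unfolding I_def by (simp add: field_simps)
qed

theorem mainTheorem7:
  fixes mul :: "'g::t2_space \<Rightarrow> 'g \<Rightarrow> 'g" and one :: 'g and iv :: "'g \<Rightarrow> 'g"
    and \<mu> :: "'g measure"
    and R :: "'g \<Rightarrow> complex^'n^'n"
    and Hs :: "'g set"
    and w :: "'n \<Rightarrow> complex^'n" and blk :: "'n \<Rightarrow> 'k" and k0 :: 'k
    and E :: "(complex^'n^'n) set"
    and \<rho> :: "'g \<Rightarrow> complex^'d^'d"
    and e :: "'s::finite \<Rightarrow> complex^'n^'n"
  assumes G: "compact_group mul one iv"
    and haar: "normalized_haar mul \<mu>"
    and rep: "cont_unitary_rep mul one R"
    and H: "closed_abelian_subgroup mul one iv Hs"
    and W: "NDCSE R Hs w blk"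
    and k0: "k0 \<in> range blk"
    and E_sub: "E \<subseteq> End_block w blk k0"
    and E_irr: "irreducible_submodule mscale (conj_action R) UNIV E"
    and lam_rep: "cont_unitary_rep mul one \<rho>"
    and lam_irr: "irreducible_submodule (*s) (\<lambda>g v. \<rho> g *v v) UNIV UNIV"
    and E_iso: "isomorphic_modules (*s) (\<lambda>g v. \<rho> g *v v) UNIV mscale (conj_action R) E UNIV"
    and e_in: "\<And>\<sigma>. e \<sigma> \<in> E"
    and e_on: "\<And>\<sigma> \<tau>. hs_inner (e \<sigma>) (e \<tau>) = (if \<sigma> = \<tau> then 1 else 0)"
    and e_span: "module.span mscale (range e) = E"
    and e_diag: "\<And>\<sigma>. diagonal_in w blk k0 (e \<sigma>) \<or> zero_diagonal_in w blk k0 (e \<sigma>)"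
  shows "\<forall>\<tau>. (\<integral>g. (\<Sum>\<sigma>\<in>{\<sigma>. diagonal_in w blk k0 (e \<sigma>)}.
               (cmod (trace (adj (e \<sigma>) ** R g ** e \<tau> ** adj (R g))))\<^sup>2) \<partial>\<mu>)
             = real (fixed_dim \<rho> Hs) / real CARD('d)"
proof
  fix \<tau>
  let ?D = "{\<sigma>. diagonal_in w blk k0 (e \<sigma>)}"
  have e: "hs_onb e E" unfolding hs_onb_def using e_on e_span by blast
  have U: "\<And>h. unitary_mat (R h)" using rep unfolding cont_unitary_rep_def by blast
  obtain T where T: "Vector_Spaces.linear (*s) mscale T" "bij_betw T UNIV E"
    and T_act: "\<And>g x. T (\<rho> g *v x) = conj_action R g (T x)"
    using E_iso unfolding isomorphic_modules_def by blast
  have "(\<integral>g. (\<Sum>\<sigma>\<in>?D. (cmod (trace (adj (e \<sigma>) ** R g ** e \<tau> ** adj (R g))))\<^sup>2) \<partial>\<mu>)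
      = (\<integral>g. (\<Sum>\<sigma>\<in>?D. (cmod (coeff_matrix e R g $ \<sigma> $ \<tau>))\<^sup>2) \<partial>\<mu>)"
    by (simp only: coeff_matrix_component)
  also have "\<dots> = (\<Sum>\<sigma>\<in>?D. \<integral>g. (cmod (coeff_matrix e R g $ \<sigma> $ \<tau>))\<^sup>2 \<partial>\<mu>)"
    by (rule Bochner_Integration.integral_sum) (rule schur_orthogonality(1)[OF G haar rep e E_irr])
  also have "\<dots> = real (card ?D) / real CARD('s)"
    by (simp add: schur_orthogonality(2)[OF G haar rep e E_irr])
  also have "\<dots> = real (fixed_dim \<rho> Hs) / real CARD('d)"
    using card_diagonal_eq_fixed_dim[OF W k0 U E_sub e e_diag T T_act] card_hs_onb_eq_dim[OF e T]
    by simp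
  finally show "(\<integral>g. (\<Sum>\<sigma>\<in>?D. (cmod (trace (adj (e \<sigma>) ** R g ** e \<tau> ** adj (R g))))\<^sup>2) \<partial>\<mu>)
      = real (fixed_dim \<rho> Hs) / real CARD('d)" .
qed

end
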